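(* In the binary random graph affiliation mixture model with $Q\ge2$ groups, uniform group priors $\pi_q=1/Q$, and $\alpha\ne\beta$, let $m_1=\mathbb E(X_{12})$ and $m_{41}=\mathbb E(X_{12}X_{23}X_{34}X_{14})$. Then $m_{41}>m_1^4$.
   Context: Random graph mixture model: nodes have i.i.d. latent groups $Z_i\in\{1,\dots,Q\}$ with $\pi_q=\mathbb P(Z_i=q)$; edge variables $X_{ij}$ ($i<j$) are conditionally independent given all $Z$'s, with law of $X_{ij}$ depending only on $(Z_i,Z_j)$. Binary affiliation model: $X_{ij}\in\{0,1\}$ with $\mathbb P(X_{ij}=1\mid Z_i=q,Z_j=l)=\alpha$ if $q=l$ and $=\beta$ if $q\ne l$. *)

theory Defs
  imports "HOL-Probability.Probability"
begin

definition affil :: "real \<Rightarrow> real \<Rightarrow> nat \<Rightarrow> nat \<Rightarrow> real" where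
  "affil \<alpha> \<beta> q l = (if q = l then \<alpha> else \<beta>)"

definition node_pairs :: "nat \<Rightarrow> (nat \<times> nat) set" where
  "node_pairs n = {(i, j). 1 \<le> i \<and> i < j \<and> j \<le> n}"

definition affil_model ::
  "nat \<Rightarrow> nat pmf \<Rightarrow> real \<Rightarrow> real \<Rightarrow> nat \<Rightarrow> ((nat \<Rightarrow> nat) \<times> (nat \<times> nat \<Rightarrow> bool)) pmf" where
  "affil_model Q prior \<alpha> \<beta> n =
     do { Z \<leftarrow> Pi_pmf {1..n} 0 (\<lambda>_. prior);
          X \<leftarrow> Pi_pmf (node_pairs n) False
                 (\<lambda>(i, j). bernoulli_pmf (affil \<alpha> \<beta> (Z i) (Z j)));
          return_pmf (Z, X) }"

definition uniform_groups :: "nat \<Rightarrow> nat pmf" where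
  "uniform_groups Q = pmf_of_set {1..Q}"

end

theory Submission
  imports Defs
begin

(* Conditionally on the latent groups Z, the edge indicators are independent
   Bernoulli variables, so the probability that all edges of a set E are present is
   E_Z [prod_{(i,j) in E} A (Z i) (Z j)], where A = beta J + (alpha - beta) I is the
   Q x Q connectivity matrix.  With uniform priors this gives
     m1  = (1/Q^2) * sum_{q,l} A q l            = (Q beta + (alpha - beta)) / Q,
     m41 = (1/Q^4) * trace (A^4)                = (Q^2 c^2 + Q (2 c d + d^2)) / Q^4,
   since A^2 = c J + d I with c = Q beta^2 + 2 beta (alpha - beta), d = (alpha - beta)^2.
   Moreover (Q beta + alpha - beta)^2 = Q c + d, so  Q^4 (m41 - m1^4) = (Q - 1) d^2 > 0.
   The file first collects expectation rules for finite pmfs, then evaluates edge-set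
   probabilities in the affiliation model, then the sums over group labels, and finally
   combines the two closed forms with the elementary inequality above. *)

lemma expectation_bind_pmf_finite:
  fixes h :: "'b \<Rightarrow> real"
  assumes "finite (set_pmf p)" "\<And>x. x \<in> set_pmf p \<Longrightarrow> finite (set_pmf (f x))"
  shows "measure_pmf.expectation (bind_pmf p f) h
       = measure_pmf.expectation p (\<lambda>x. measure_pmf.expectation (f x) h)"
proof -
  have "measure_pmf.expectation (bind_pmf p f) h
      = (\<Sum>a\<in>set_pmf p. pmf p a *\<^sub>R measure_pmf.expectation (f a) h)"
    using assms by (intro pmf_expectation_bind) auto
  also have "\<dots> = measure_pmf.expectation p (\<lambda>x. measure_pmf.expectation (f x) h)"
    using assms by (subst integral_measure_pmf[of "set_pmf p"]) auto
  finally show ?thesis .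
qed

lemma finite_set_Pi_pmf:
  assumes "finite A" "\<And>x. x \<in> A \<Longrightarrow> finite (set_pmf (p x))"
  shows "finite (set_pmf (Pi_pmf A d p))"
  using assms by (subst set_Pi_pmf) (auto intro!: finite_PiE_dflt)

lemma expectation_Pi_pmf_insert:
  fixes h :: "_ \<Rightarrow> real"
  assumes "finite A" "x \<notin> A" "\<And>y. finite (set_pmf (p y))"
  shows "measure_pmf.expectation (Pi_pmf (insert x A) d p) h =
    measure_pmf.expectation (p x)
      (\<lambda>y. measure_pmf.expectation (Pi_pmf A d p) (\<lambda>f. h (f(x := y))))"
  using assms
  by (simp add: Pi_pmf_insert pair_pmf_def expectation_bind_pmf_finite finite_set_Pi_pmf)

lemma expectation_all_Pi_bernoulli:
  fixes p :: "'a \<Rightarrow> real"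
  assumes A: "finite A" and E: "E \<subseteq> A" and p: "\<And>e. 0 \<le> p e \<and> p e \<le> 1"
  shows "measure_pmf.expectation (Pi_pmf A False (\<lambda>e. bernoulli_pmf (p e)))
           (\<lambda>X. of_bool (\<forall>e\<in>E. X e) :: real) = (\<Prod>e\<in>E. p e)"
proof -
  define g where "g e b = (if e \<in> E then of_bool b else 1 :: real)" for e b
  have E_eq: "A \<inter> E = E" using E by blast
  have "of_bool (\<forall>e\<in>E. X e) = (\<Prod>e\<in>A. g e (X e))" for X :: "'a \<Rightarrow> bool"
  proof -
    have "(\<Prod>e\<in>A. g e (X e)) = (\<Prod>e\<in>E. of_bool (X e) :: real)"
      using A by (simp add: g_def prod.If_cases E_eq)
    also have "\<dots> = of_bool (\<forall>e\<in>E. X e)"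
      using finite_subset[OF E A] by (induction E rule: finite_induct) auto
    finally show ?thesis by simp
  qed
  then have "measure_pmf.expectation (Pi_pmf A False (\<lambda>e. bernoulli_pmf (p e)))
               (\<lambda>X. of_bool (\<forall>e\<in>E. X e) :: real)
           = measure_pmf.expectation (Pi_pmf A False (\<lambda>e. bernoulli_pmf (p e)))
               (\<lambda>X. \<Prod>e\<in>A. g e (X e))"
    by simp
  also have "\<dots> = (\<Prod>e\<in>A. measure_pmf.expectation (bernoulli_pmf (p e)) (g e))"
    using A by (intro expectation_prod_Pi_pmf) (auto simp: g_def integrable_measure_pmf_finite)
  also have "\<dots> = (\<Prod>e\<in>A. if e \<in> E then p e else 1)"
    using p by (intro prod.cong refl) (auto simp: g_def integral_measure_pmf[of UNIV] UNIV_bool)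
  also have "\<dots> = (\<Prod>e\<in>E. p e)"
    using A by (simp add: prod.If_cases E_eq)
  finally show ?thesis .
qed

lemma finite_node_pairs: "finite (node_pairs n)"
  unfolding node_pairs_def by (rule finite_subset[of _ "{1..n} \<times> {1..n}"]) auto

lemma affil_model_all_edges:
  assumes E: "E \<subseteq> node_pairs n" and prior: "finite (set_pmf prior)"
    and ab: "0 \<le> \<alpha>" "\<alpha> \<le> 1" "0 \<le> \<beta>" "\<beta> \<le> 1"
  shows "measure_pmf.expectation (affil_model Q prior \<alpha> \<beta> n)
           (\<lambda>(Z, X). of_bool (\<forall>e\<in>E. X e) :: real)
       = measure_pmf.expectation (Pi_pmf {1..n} 0 (\<lambda>_. prior))
           (\<lambda>Z. \<Prod>(i, j)\<in>E. affil \<alpha> \<beta> (Z i) (Z j))"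
proof -
  have p: "0 \<le> affil \<alpha> \<beta> q l \<and> affil \<alpha> \<beta> q l \<le> 1" for q l
    using ab by (simp add: affil_def)
  have edges: "measure_pmf.expectation
      (Pi_pmf (node_pairs n) False (\<lambda>(i, j). bernoulli_pmf (affil \<alpha> \<beta> (Z i) (Z j))))
      (\<lambda>X. of_bool (\<forall>e\<in>E. X e) :: real) = (\<Prod>(i, j)\<in>E. affil \<alpha> \<beta> (Z i) (Z j))" for Z :: "nat \<Rightarrow> nat"
    using expectation_all_Pi_bernoulli[OF finite_node_pairs E,
        of "\<lambda>(i, j). affil \<alpha> \<beta> (Z i) (Z j)"] p
    by (simp add: case_prod_unfold)
  show ?thesis
    unfolding affil_model_def
    by (simp add: expectation_bind_pmf_finite finite_set_Pi_pmf finite_node_pairs prior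
        edges split_beta)
qed

lemma finite_set_uniform_groups: "Q \<ge> 1 \<Longrightarrow> finite (set_pmf (uniform_groups Q))"
  by (simp add: uniform_groups_def)

lemma expectation_first_four_groups:
  fixes g :: "nat \<Rightarrow> nat \<Rightarrow> nat \<Rightarrow> nat \<Rightarrow> real" and n Q :: nat
  assumes n: "n \<ge> 4" and Q: "Q \<ge> 1"
  shows "measure_pmf.expectation (Pi_pmf {1..n} 0 (\<lambda>_. uniform_groups Q))
           (\<lambda>Z. g (Z 1) (Z 2) (Z 3) (Z 4))
    = (\<Sum>y1\<in>{1..Q}. \<Sum>y2\<in>{1..Q}. \<Sum>y3\<in>{1..Q}. \<Sum>y4\<in>{1..Q}. g y1 y2 y3 y4) / real Q ^ 4"
proof -
  have nodes: "{1..n} = insert 1 (insert 2 (insert 3 (insert 4 {5..n})))" using n by auto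
  have uniform: "measure_pmf.expectation (uniform_groups Q) f = (\<Sum>q\<in>{1..Q}. f q) / real Q"
    for f :: "nat \<Rightarrow> real"
    using Q by (simp add: uniform_groups_def integral_pmf_of_set)
  show ?thesis unfolding nodes
    by (simp add: expectation_Pi_pmf_insert finite_set_uniform_groups[OF Q] uniform
        power4_eq_xxxx mult.assoc flip: sum_divide_distrib)
qed

text \<open>The connectivity matrix is symmetric; this closes the four-cycle into a trace.\<close>
lemma affil_sym: "affil a b q l = affil a b l q"
  by (auto simp: affil_def)

lemma affil_row_sum:
  fixes a b :: real
  assumes "finite S" "q \<in> S"
  shows "(\<Sum>z\<in>S. affil a b q z) = real (card S) * b + (a - b)"
proof -
  have "affil a b q z = b + (a - b) * of_bool (z = q)" for z
    by (auto simp: affil_def)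
  then show ?thesis using assms by (simp add: sum.distrib flip: sum_distrib_left)
qed

lemma affil_two_path_sum:
  fixes a b :: real
  assumes "finite S" "q \<in> S" "l \<in> S"
  shows "(\<Sum>z\<in>S. affil a b q z * affil a b z l)
       = (real (card S) * b^2 + 2*b*(a - b)) + (a - b)^2 * of_bool (q = l)"
proof -
  have "affil a b q z * affil a b z l = b^2 + b*(a - b) * of_bool (z = l)
      + b*(a - b) * of_bool (z = q) + (a - b)^2 * of_bool (q = l) * of_bool (z = q)" for z
    by (auto simp: affil_def power2_eq_square algebra_simps)
  then show ?thesis using assms by (simp add: sum.distrib flip: sum_distrib_left)
qed

lemma affil_four_cycle_sum:
  fixes a b :: real
  assumes S: "finite S"
  defines "c \<equiv> real (card S) * b^2 + 2*b*(a - b)" and "d \<equiv> (a - b)^2"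
  shows "(\<Sum>y1\<in>S. \<Sum>y2\<in>S. \<Sum>y3\<in>S. \<Sum>y4\<in>S.
            affil a b y1 y2 * affil a b y2 y3 * affil a b y3 y4 * affil a b y1 y4)
       = real (card S)^2 * c^2 + real (card S) * (2*c*d + d^2)"
proof -
  let ?a = "affil a b"
  let ?B = "\<lambda>q l. c + d * of_bool (q = l)"
  have B: "(\<Sum>z\<in>S. ?a q z * ?a z l) = ?B q l" if "q \<in> S" "l \<in> S" for q l
    using affil_two_path_sum[OF S that] unfolding c_def d_def by simp
  have "(\<Sum>y1\<in>S. \<Sum>y2\<in>S. \<Sum>y3\<in>S. \<Sum>y4\<in>S. ?a y1 y2 * ?a y2 y3 * ?a y3 y4 * ?a y1 y4)
      = (\<Sum>y1\<in>S. \<Sum>y2\<in>S. \<Sum>y3\<in>S. ?a y1 y2 * ?a y2 y3 * ?B y3 y1)"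
  proof (intro sum.cong refl)
    fix y1 y2 y3 assume "y1 \<in> S" "y3 \<in> S"
    then show "(\<Sum>y4\<in>S. ?a y1 y2 * ?a y2 y3 * ?a y3 y4 * ?a y1 y4) = ?a y1 y2 * ?a y2 y3 * ?B y3 y1"
      by (simp add: B mult.assoc affil_sym[of a b y1] flip: sum_distrib_left)
  qed
  also have "\<dots> = (\<Sum>y1\<in>S. \<Sum>y3\<in>S. ?B y3 y1 * (\<Sum>y2\<in>S. ?a y1 y2 * ?a y2 y3))"
    by (subst sum.swap) (simp add: sum_distrib_left mult_ac)
  also have "\<dots> = (\<Sum>y1\<in>S. \<Sum>y3\<in>S. c^2 + (2*c*d + d^2) * of_bool (y3 = y1))"
    by (intro sum.cong refl) (auto simp: B power2_eq_square algebra_simps)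
  also have "\<dots> = real (card S)^2 * c^2 + real (card S) * (2*c*d + d^2)"
    using S by (simp add: sum.distrib power2_eq_square algebra_simps flip: sum_distrib_left)
  finally show ?thesis .
qed

lemma affil_edge_moment:
  assumes Q: "Q \<ge> 1" and n: "n \<ge> 4" and ab: "0 \<le> \<alpha>" "\<alpha> \<le> 1" "0 \<le> \<beta>" "\<beta> \<le> 1"
  shows "measure_pmf.expectation (affil_model Q (uniform_groups Q) \<alpha> \<beta> n)
           (\<lambda>(Z, X). of_bool (X (1,2)) :: real) = (real Q * \<beta> + (\<alpha> - \<beta>)) / real Q"
proof -
  have E: "{(1::nat, 2::nat)} \<subseteq> node_pairs n" using n by (auto simp: node_pairs_def)
  have "measure_pmf.expectation (affil_model Q (uniform_groups Q) \<alpha> \<beta> n)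
          (\<lambda>(Z, X). of_bool (X (1,2)) :: real)
      = measure_pmf.expectation (Pi_pmf {1..n} 0 (\<lambda>_. uniform_groups Q))
          (\<lambda>Z. (\<lambda>y1 y2 y3 y4. affil \<alpha> \<beta> y1 y2) (Z 1) (Z 2) (Z 3) (Z 4))"
    using affil_model_all_edges[OF E finite_set_uniform_groups[OF Q] ab] by simp
  also have "\<dots> = (\<Sum>y1\<in>{1..Q}. \<Sum>y2\<in>{1..Q}. \<Sum>y3\<in>{1..Q}. \<Sum>y4\<in>{1..Q}.
                    affil \<alpha> \<beta> y1 y2) / real Q ^ 4"
    by (rule expectation_first_four_groups[OF n Q])
  also have "\<dots> = (\<Sum>y1\<in>{1..Q}. real Q ^ 2 * (\<Sum>y2\<in>{1..Q}. affil \<alpha> \<beta> y1 y2)) / real Q ^ 4"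
    by (simp add: power2_eq_square mult.assoc flip: sum_distrib_left)
  also have "\<dots> = (real Q * \<beta> + (\<alpha> - \<beta>)) / real Q"
    using Q by (simp add: affil_row_sum power2_eq_square power4_eq_xxxx)
  finally show ?thesis .
qed

lemma affil_four_cycle_moment:
  assumes Q: "Q \<ge> 1" and n: "n \<ge> 4" and ab: "0 \<le> \<alpha>" "\<alpha> \<le> 1" "0 \<le> \<beta>" "\<beta> \<le> 1"
  defines "c \<equiv> real Q * \<beta>^2 + 2*\<beta>*(\<alpha> - \<beta>)" and "d \<equiv> (\<alpha> - \<beta>)^2"
  shows "measure_pmf.expectation (affil_model Q (uniform_groups Q) \<alpha> \<beta> n)
           (\<lambda>(Z, X). of_bool (X (1,2) \<and> X (2,3) \<and> X (3,4) \<and> X (1,4)) :: real)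
       = (real Q^2 * c^2 + real Q * (2*c*d + d^2)) / real Q ^ 4"
proof -
  let ?a = "affil \<alpha> \<beta>"
  let ?cycle = "\<lambda>y1 y2 y3 y4. ?a y1 y2 * ?a y2 y3 * ?a y3 y4 * ?a y1 y4"
  let ?E = "{(1::nat, 2::nat), (2, 3), (3, 4), (1, 4)}"
  have E: "?E \<subseteq> node_pairs n" using n by (auto simp: node_pairs_def)
  have "measure_pmf.expectation (affil_model Q (uniform_groups Q) \<alpha> \<beta> n)
          (\<lambda>(Z, X). of_bool (X (1,2) \<and> X (2,3) \<and> X (3,4) \<and> X (1,4)) :: real)
      = measure_pmf.expectation (Pi_pmf {1..n} 0 (\<lambda>_. uniform_groups Q))
          (\<lambda>Z. ?cycle (Z 1) (Z 2) (Z 3) (Z 4))"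
    using affil_model_all_edges[OF E finite_set_uniform_groups[OF Q] ab]
    by (simp add: mult_ac)
  also have "\<dots> = (\<Sum>y1\<in>{1..Q}. \<Sum>y2\<in>{1..Q}. \<Sum>y3\<in>{1..Q}. \<Sum>y4\<in>{1..Q}.
                    ?cycle y1 y2 y3 y4) / real Q ^ 4"
    by (rule expectation_first_four_groups[OF n Q])
  also have "\<dots> = (real Q^2 * c^2 + real Q * (2*c*d + d^2)) / real Q ^ 4"
    using affil_four_cycle_sum[of "{1..Q}" \<alpha> \<beta>] by (simp add: c_def d_def)
  finally show ?thesis .
qed

lemma four_cycle_excess:
  fixes Q c d :: real
  assumes "Q > 1" "d \<noteq> 0"
  shows "(Q * c + d)^2 < Q^2 * c^2 + Q * (2*c*d + d^2)"
proof -
  have "Q^2 * c^2 + Q * (2*c*d + d^2) - (Q * c + d)^2 = (Q - 1) * d^2"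
    by (simp add: power2_eq_square algebra_simps)
  moreover have "(Q - 1) * d^2 > 0" using assms by simp
  ultimately show ?thesis by linarith
qed

theorem lemma4:
  fixes Q n :: nat and \<alpha> \<beta> :: real
  assumes "Q \<ge> 2" and "n \<ge> 4"
    and "0 \<le> \<alpha>" "\<alpha> \<le> 1" "0 \<le> \<beta>" "\<beta> \<le> 1"
    and "\<alpha> \<noteq> \<beta>"
  shows "measure_pmf.expectation (affil_model Q (uniform_groups Q) \<alpha> \<beta> n)
           (\<lambda>(Z, X). of_bool (X (1,2) \<and> X (2,3) \<and> X (3,4) \<and> X (1,4)) :: real)
       > (measure_pmf.expectation (affil_model Q (uniform_groups Q) \<alpha> \<beta> n)
           (\<lambda>(Z, X). of_bool (X (1,2)) :: real)) ^ 4"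
proof -
  define c where "c = real Q * \<beta>^2 + 2*\<beta>*(\<alpha> - \<beta>)"
  define d where "d = (\<alpha> - \<beta>)^2"
  have Q: "Q \<ge> 1" and Q_gt: "real Q > 1" using assms(1) by simp_all
  have square: "(real Q * \<beta> + (\<alpha> - \<beta>))^2 = real Q * c + d"
    by (simp add: c_def d_def power2_eq_square algebra_simps)
  have "((real Q * \<beta> + (\<alpha> - \<beta>)) / real Q)^4 = (real Q * c + d)^2 / real Q ^ 4"
    by (simp add: power_divide flip: square power_mult)
  also have "\<dots> < (real Q^2 * c^2 + real Q * (2*c*d + d^2)) / real Q ^ 4"
    using Q_gt assms(7) by (intro divide_strict_right_mono four_cycle_excess) (simp_all add: d_def)
  finally show ?thesis
    using affil_edge_moment[OF Q assms(2-6)] affil_four_cycle_moment[OF Q assms(2-6)]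
    by (simp add: c_def d_def)
qed

end
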